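(* Let $(X,d)$ be a complete semimetric space with a continuous triangle function $\Phi$ satisfying the following conditions: 1) $\Phi(ku,kv)=k\Phi(u,v)$ for all $k,u,v\in[0,\infty)$; 2) for every $0\leqslant a<1$ there exists $C(a)>0$ such that for every positive integer $p$ one has $\Phi(1,\Phi(a,\Phi(a^2,\ldots,\Phi(a^{p-1},a^{p}))))\leqslant C(a)$. Let $\alpha,\beta,\gamma\geqslant0$ with $\alpha+\beta+\gamma<1$, and let $T\colon X\to X$ satisfy $$d(Tx,Ty)\leqslant\alpha\, d(x,y)+\beta\, d(x,Tx)+\gamma\, d(y,Ty)\quad\text{for all }x,y\in X.$$ Suppose additionally that $\Phi(0,\gamma)<1$. Then $T$ has a unique fixed point.
   Context: Let $X$ be a nonempty set. A semimetric on $X$ is a map $d\colon X\times X\to[0,\infty)$ such that $d(x,y)=0$ if and only if $x=y$, and $d(x,y)=d(y,x)$ for all $x,y\in X$ (no triangle inequality is required). The pair $(X,d)$ is then called a semimetric space. A function $\Phi\colon[0,\infty)\times[0,\infty)\to[0,\infty)$ is a triangle function for $d$ if $\Phi$ is symmetric, nondecreasing in each of its arguments, $\Phi(0,0)=0$, and $d(x,y)\leqslant\Phi(d(x,z),d(z,y))$ for all $x,y,z\in X$. Convergence, Cauchy sequences and completeness are defined as usual: $x_n\to x$ means $d(x_n,x)\to0$; $(x_n)$ is Cauchy if for every $\varepsilon>0$ there is $N$ with $d(x_n,x_m)<\varepsilon$ for all $n,m\geqslant N$; $(X,d)$ is complete if every Cauchy sequence converges to a point of $X$. For $p=1$ the nested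 expression in condition 2) is $\Phi(1,a)$, for $p=2$ it is $\Phi(1,\Phi(a,a^2))$, and so on (with $a^0=1$). *)

theory Defs
  imports "HOL-Analysis.Analysis"
begin

locale semimetric_space =
  fixes X :: "'a set" and d :: "'a \<Rightarrow> 'a \<Rightarrow> real"
  assumes nonempty: "X \<noteq> {}"
    and nonneg: "\<lbrakk>x \<in> X; y \<in> X\<rbrakk> \<Longrightarrow> 0 \<le> d x y"
    and zero_iff: "\<lbrakk>x \<in> X; y \<in> X\<rbrakk> \<Longrightarrow> d x y = 0 \<longleftrightarrow> x = y"
    and commute: "\<lbrakk>x \<in> X; y \<in> X\<rbrakk> \<Longrightarrow> d x y = d y x"

definition semimetric_converges :: "('a \<Rightarrow> 'a \<Rightarrow> real) \<Rightarrow> (nat \<Rightarrow> 'a) \<Rightarrow> 'a \<Rightarrow> bool" where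
  "semimetric_converges d s x \<longleftrightarrow> (\<lambda>n. d (s n) x) \<longlonglongrightarrow> 0"

definition semimetric_Cauchy :: "('a \<Rightarrow> 'a \<Rightarrow> real) \<Rightarrow> (nat \<Rightarrow> 'a) \<Rightarrow> bool" where
  "semimetric_Cauchy d s \<longleftrightarrow> (\<forall>\<epsilon>>0. \<exists>N. \<forall>n\<ge>N. \<forall>m\<ge>N. d (s n) (s m) < \<epsilon>)"

definition semimetric_complete :: "'a set \<Rightarrow> ('a \<Rightarrow> 'a \<Rightarrow> real) \<Rightarrow> bool" where
  "semimetric_complete X d \<longleftrightarrow>
     (\<forall>s. range s \<subseteq> X \<and> semimetric_Cauchy d s \<longrightarrow> (\<exists>x\<in>X. semimetric_converges d s x))"

text \<open>Functions \<open>[0,\<infinity>) \<times> [0,\<infinity>) \<rightarrow> [0,\<infinity>)\<close> are represented by curried real functions;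
  every condition on \<open>\<Phi>\<close> is restricted to nonnegative arguments.\<close>

locale triangle_function =
  fixes X :: "'a set" and d :: "'a \<Rightarrow> 'a \<Rightarrow> real" and \<Phi> :: "real \<Rightarrow> real \<Rightarrow> real"
  assumes nonneg: "\<lbrakk>0 \<le> u; 0 \<le> v\<rbrakk> \<Longrightarrow> 0 \<le> \<Phi> u v"
    and symmetric: "\<lbrakk>0 \<le> u; 0 \<le> v\<rbrakk> \<Longrightarrow> \<Phi> u v = \<Phi> v u"
    and mono_left: "\<lbrakk>0 \<le> u; u \<le> u'; 0 \<le> v\<rbrakk> \<Longrightarrow> \<Phi> u v \<le> \<Phi> u' v"
    and mono_right: "\<lbrakk>0 \<le> u; 0 \<le> v; v \<le> v'\<rbrakk> \<Longrightarrow> \<Phi> u v \<le> \<Phi> u v'"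
    and zero: "\<Phi> 0 0 = 0"
    and triangle: "\<lbrakk>x \<in> X; y \<in> X; z \<in> X\<rbrakk> \<Longrightarrow> d x y \<le> \<Phi> (d x z) (d z y)"

text \<open>\<open>nested \<Phi> a i n\<close> is \<open>\<Phi>(a\<^sup>i, \<Phi>(a\<^bsup>i+1\<^esup>, \<dots>, \<Phi>(a\<^bsup>i+n-1\<^esup>, a\<^bsup>i+n\<^esup>)))\<close>, with \<open>n\<close>
  applications of \<open>\<Phi>\<close>.\<close>

fun nested :: "(real \<Rightarrow> real \<Rightarrow> real) \<Rightarrow> real \<Rightarrow> nat \<Rightarrow> nat \<Rightarrow> real" where
  "nested \<Phi> a i 0 = a ^ i"
| "nested \<Phi> a i (Suc n) = \<Phi> (a ^ i) (nested \<Phi> a (Suc i) n)"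

end

theory Submission
  imports Defs
begin

text \<open>The Picard iterates satisfy \<open>d(x\<^sub>n, x\<^bsub>n+1\<^esub>) \<le> c q\<^sup>n\<close> with
  \<open>q = (\<alpha> + \<beta>) / (1 - \<gamma>)\<close>. Repeated use of the triangle function and homogeneity bound
  \<open>d(x\<^sub>n, x\<^bsub>n+p\<^esub>)\<close> by \<open>c q\<^sup>n\<close> times the nested expression, so the iterates converge
  to some \<open>x\<close>. Continuity of \<open>\<Phi>\<close> then yields \<open>d(x, Tx) \<le> \<Phi>(0, \<gamma> d(x, Tx)) = \<Phi>(0, \<gamma>) d(x, Tx)\<close>,
  which forces \<open>Tx = x\<close>.\<close>

lemma (in triangle_function) nested_nonneg:
  assumes "0 \<le> a"
  shows "0 \<le> nested \<Phi> a i n"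
  using assms by (induction n arbitrary: i) (auto intro: nonneg)

text \<open>Raising the starting exponent by \<open>i\<close> multiplies every power inside by
  \<open>a ^ i\<close>, and homogeneity moves this common factor outside. It turns a bound on the
  expression starting at exponent 0 into geometric decay in \<open>i\<close>.\<close>

lemma (in triangle_function) nested_shift:
  assumes hom: "\<And>k u v. \<lbrakk>0 \<le> k; 0 \<le> u; 0 \<le> v\<rbrakk> \<Longrightarrow> \<Phi> (k * u) (k * v) = k * \<Phi> u v"
    and a: "0 \<le> a"
  shows "nested \<Phi> a i n = a ^ i * nested \<Phi> a 0 n"
proof (induction n arbitrary: i)
  case 0
  show ?case by simp
next
  case (Suc n)
  have "nested \<Phi> a i (Suc n) = \<Phi> (a ^ i * 1) (a ^ i * (a * nested \<Phi> a 0 n))"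
    using Suc.IH[of "Suc i"] by (simp add: mult_ac)
  also have "\<dots> = a ^ i * \<Phi> 1 (a * nested \<Phi> a 0 n)"
    using hom[of "a ^ i" 1 "a * nested \<Phi> a 0 n"] a nested_nonneg[OF a] by simp
  \<comment> \<open>The induction hypothesis serves a second time, now at \<open>Suc 0\<close>, to
    fold \<open>a * nested \<Phi> a 0 n\<close> back into
    \<open>nested \<Phi> a (Suc 0) n\<close>.\<close>
  also have "\<dots> = a ^ i * nested \<Phi> a 0 (Suc n)"
    using Suc.IH[of "Suc 0"] by simp
  finally show ?case .
qed

text \<open>Induction peels off the first step, with \<open>s (Suc i)\<close> as intermediate point;
  homogeneity extracts \<open>c\<close>. Since \<open>n\<close> applications of
  \<open>\<Phi>\<close> combine \<open>n + 1\<close> steps, the endpoint has index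
  \<open>Suc (i + n)\<close>.\<close>

lemma (in triangle_function) dist_le_nested:
  assumes "semimetric_space X d"
    and hom: "\<And>k u v. \<lbrakk>0 \<le> k; 0 \<le> u; 0 \<le> v\<rbrakk> \<Longrightarrow> \<Phi> (k * u) (k * v) = k * \<Phi> u v"
    and s: "\<And>n. s n \<in> X"
    and step: "\<And>n. d (s n) (s (Suc n)) \<le> c * q ^ n"
    and c: "0 \<le> c" and q: "0 \<le> q"
  shows "d (s i) (s (Suc (i + n))) \<le> c * nested \<Phi> q i n"
proof (induction n arbitrary: i)
  case 0
  show ?case using step[of i] by simp
next
  case (Suc n)
  interpret S: semimetric_space X d by fact
  have IH: "d (s (Suc i)) (s (Suc (i + Suc n))) \<le> c * nested \<Phi> q (Suc i) n"
    using Suc.IH[of "Suc i"] by simp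
  have "d (s i) (s (Suc (i + Suc n)))
      \<le> \<Phi> (d (s i) (s (Suc i))) (d (s (Suc i)) (s (Suc (i + Suc n))))"
    by (intro triangle s)
  also have "\<dots> \<le> \<Phi> (c * q ^ i) (d (s (Suc i)) (s (Suc (i + Suc n))))"
    by (intro mono_left S.nonneg s step)
  also have "\<dots> \<le> \<Phi> (c * q ^ i) (c * nested \<Phi> q (Suc i) n)"
    using c q by (intro mono_right S.nonneg s IH) simp
  also have "\<dots> = c * nested \<Phi> q i (Suc n)"
    using hom[of c "q ^ i" "nested \<Phi> q (Suc i) n"] c q nested_nonneg[OF q] by simp
  finally show ?case .
qed

text \<open>For \<open>i < j\<close> the distance is at most \<open>c * C * q ^ i\<close>, a bound
  independent of \<open>j\<close> that tends to 0.\<close>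

lemma (in triangle_function) geometric_imp_Cauchy:
  assumes "semimetric_space X d"
    and hom: "\<And>k u v. \<lbrakk>0 \<le> k; 0 \<le> u; 0 \<le> v\<rbrakk> \<Longrightarrow> \<Phi> (k * u) (k * v) = k * \<Phi> u v"
    and bound: "\<And>p. nested \<Phi> q 0 p \<le> C"
    and s: "\<And>n. s n \<in> X"
    and step: "\<And>n. d (s n) (s (Suc n)) \<le> c * q ^ n"
    and c: "0 \<le> c" and q: "0 \<le> q" "q < 1"
  shows "semimetric_Cauchy d s"
  unfolding semimetric_Cauchy_def
proof (intro allI impI)
  fix e :: real
  assume e: "0 < e"
  interpret S: semimetric_space X d by fact
  have "(\<lambda>i. c * C * q ^ i) \<longlonglongrightarrow> c * C * 0"
    using q by (intro tendsto_intros LIMSEQ_realpow_zero)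
  then have "\<forall>\<^sub>F i in sequentially. c * C * q ^ i < e"
    using e by (auto dest: order_tendstoD(2))
  then obtain N where N: "\<And>i. i \<ge> N \<Longrightarrow> c * C * q ^ i < e"
    by (auto simp: eventually_sequentially)
  have less: "d (s i) (s j) < e" if "N \<le> i" "i < j" for i j
  proof -
    obtain n where j: "j = Suc (i + n)"
      using less_imp_Suc_add[OF \<open>i < j\<close>] by auto
    have "d (s i) (s j) \<le> c * (q ^ i * nested \<Phi> q 0 n)"
      using dist_le_nested[OF assms(1) hom s step c q(1), of i n] nested_shift[OF hom q(1), of i n]
      by (simp add: j)
    also have "\<dots> \<le> c * (q ^ i * C)"
      using c q by (intro mult_left_mono bound) auto
    also have "\<dots> < e"
      using N[OF that(1)] by (simp add: mult_ac)
    finally show ?thesis .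
  qed
  have "d (s i) (s j) < e" if "N \<le> i" "N \<le> j" for i j
    using less[of i j] less[of j i] S.commute[OF s s, of i j] S.zero_iff[OF s s, of i i] e that
    by (cases i j rule: linorder_cases) auto
  then show "\<exists>N. \<forall>n\<ge>N. \<forall>m\<ge>N. d (s n) (s m) < e"
    by blast
qed

theorem theorem5p2:
  fixes X :: "'a set" and d :: "'a \<Rightarrow> 'a \<Rightarrow> real" and \<Phi> :: "real \<Rightarrow> real \<Rightarrow> real"
    and T :: "'a \<Rightarrow> 'a" and \<alpha> \<beta> \<gamma> :: real
  assumes "semimetric_space X d"
    and "semimetric_complete X d"
    and "triangle_function X d \<Phi>"
    and "continuous_on ({0..} \<times> {0..}) (\<lambda>(u, v). \<Phi> u v)"
    and "\<And>k u v. \<lbrakk>0 \<le> k; 0 \<le> u; 0 \<le> v\<rbrakk> \<Longrightarrow> \<Phi> (k * u) (k * v) = k * \<Phi> u v"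
    and "\<And>a. \<lbrakk>0 \<le> a; a < 1\<rbrakk> \<Longrightarrow> \<exists>C>0. \<forall>p\<ge>1. nested \<Phi> a 0 p \<le> C"
    and "0 \<le> \<alpha>" "0 \<le> \<beta>" "0 \<le> \<gamma>" "\<alpha> + \<beta> + \<gamma> < 1"
    and "\<And>x. x \<in> X \<Longrightarrow> T x \<in> X"
    and "\<And>x y. \<lbrakk>x \<in> X; y \<in> X\<rbrakk> \<Longrightarrow> d (T x) (T y) \<le> \<alpha> * d x y + \<beta> * d x (T x) + \<gamma> * d y (T y)"
    and "\<Phi> 0 \<gamma> < 1"
  shows "\<exists>!x. x \<in> X \<and> T x = x"
proof (rule ex_ex1I)
  note hom = assms(5) and T = assms(11) and contr = assms(12)
  interpret S: semimetric_space X d by fact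
  interpret F: triangle_function X d \<Phi> by fact
  obtain x0 where x0: "x0 \<in> X" using S.nonempty by blast
  define s where "s n = (T ^^ n) x0" for n
  have s_Suc: "s (Suc n) = T (s n)" for n
    by (simp add: s_def)
  have s: "s n \<in> X" for n
    by (induction n) (simp_all add: s_def x0 T)
  \<comment> \<open>Applying the contraction to consecutive iterates puts the new distance on both
    sides, with coefficient \<gamma> on the right; solving for it gives this ratio.\<close>
  define q where "q = (\<alpha> + \<beta>) / (1 - \<gamma>)"
  have q: "0 \<le> q" "q < 1"
    using assms(7-10) by (simp_all add: q_def)
  have contr_step: "d (s (Suc n)) (s (Suc (Suc n))) \<le> q * d (s n) (s (Suc n))" for n
    using contr[OF s s, of n "Suc n"] assms(7-10)
    by (simp add: s_Suc q_def field_simps)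
  have step: "d (s n) (s (Suc n)) \<le> d x0 (T x0) * q ^ n" for n
  proof (induction n)
    case 0
    show ?case by (simp add: s_def)
  next
    case (Suc n)
    have "d (s (Suc n)) (s (Suc (Suc n))) \<le> q * (d x0 (T x0) * q ^ n)"
      using contr_step[of n] mult_left_mono[OF Suc.IH q(1)] by linarith
    then show ?case by (simp add: mult_ac)
  qed
  obtain C where C: "\<And>p. p \<ge> 1 \<Longrightarrow> nested \<Phi> q 0 p \<le> C"
    using assms(6)[OF q] by blast
  \<comment> \<open>The hypothesis starts at \<open>p = 1\<close>; the remaining value at
    \<open>p = 0\<close> is \<open>q ^ 0 = 1\<close>.\<close>
  have bound: "nested \<Phi> q 0 p \<le> max 1 C" for p
    using C[of p] by (cases p) auto
  have "semimetric_Cauchy d s"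
    by (rule F.geometric_imp_Cauchy[OF assms(1) hom bound s step S.nonneg q])
      (use x0 T in auto)
  then obtain x where x: "x \<in> X" and lim: "(\<lambda>n. d (s n) x) \<longlonglongrightarrow> 0"
    using assms(2) s unfolding semimetric_complete_def semimetric_converges_def by blast
  have lim_Suc: "(\<lambda>n. d (s (Suc n)) x) \<longlonglongrightarrow> 0"
    using lim by (rule LIMSEQ_Suc)
  have lim_step: "(\<lambda>n. d (s n) (s (Suc n))) \<longlonglongrightarrow> 0"
  proof (rule tendsto_sandwich[OF _ _ tendsto_const])
    show "(\<lambda>n. d x0 (T x0) * q ^ n) \<longlonglongrightarrow> 0"
      using q by (intro tendsto_mult_right_zero LIMSEQ_realpow_zero)
  qed (use S.nonneg s step in auto)
  let ?D = "d x (T x)"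
  \<comment> \<open>This is the contraction's bound on the distance from
    \<open>T (s n) = s (Suc n)\<close> to \<open>T x\<close>.\<close>
  let ?v = "\<lambda>n. \<alpha> * d (s n) x + \<beta> * d (s n) (s (Suc n)) + \<gamma> * ?D"
  have D: "0 \<le> ?D" using x T S.nonneg by blast
  have v: "0 \<le> ?v n" for n
    using assms(7-9) D S.nonneg s x by simp
  have "?v \<longlonglongrightarrow> \<alpha> * 0 + \<beta> * 0 + \<gamma> * ?D"
    by (intro tendsto_intros lim lim_step)
  then have "(\<lambda>n. (d (s (Suc n)) x, ?v n)) \<longlonglongrightarrow> (0, \<gamma> * ?D)"
    using lim_Suc by (intro tendsto_Pair) auto
  \<comment> \<open>Continuity is given only on the closed quadrant, so the sequence and its limit
    must be shown to lie there.\<close>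
  from continuous_on_tendsto_compose[OF assms(4) this]
  have "(\<lambda>n. \<Phi> (d (s (Suc n)) x) (?v n)) \<longlonglongrightarrow> \<Phi> 0 (\<gamma> * ?D)"
    using assms(9) D v S.nonneg[OF s x] by simp
  moreover have "?D \<le> \<Phi> (d (s (Suc n)) x) (?v n)" for n
  proof -
    have "?D \<le> \<Phi> (d x (s (Suc n))) (d (s (Suc n)) (T x))"
      using x T s by (intro F.triangle) auto
    also have "\<dots> \<le> \<Phi> (d x (s (Suc n))) (?v n)"
      using x T s contr[OF s x, of n] by (intro F.mono_right S.nonneg) (auto simp: s_Suc)
    finally show ?thesis using S.commute[OF x s] by simp
  qed
  ultimately have "?D \<le> \<Phi> 0 (\<gamma> * ?D)"
    by (intro LIMSEQ_le_const) auto
  also have "\<dots> = ?D * \<Phi> 0 \<gamma>"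
    using hom[OF D, of 0 \<gamma>] assms(9) by (simp add: mult.commute)
  finally have "?D * (1 - \<Phi> 0 \<gamma>) \<le> 0"
    by (simp add: algebra_simps)
  then have "?D = 0"
    using D assms(13) by (simp add: mult_le_0_iff)
  then show "\<exists>x. x \<in> X \<and> T x = x"
    using S.zero_iff[OF x T[OF x]] x by auto
next
  fix x y
  assume x: "x \<in> X \<and> T x = x" and y: "y \<in> X \<and> T y = y"
  interpret S: semimetric_space X d by fact
  \<comment> \<open>At fixed points the \<beta> and \<gamma> terms vanish.\<close>
  have "d x y \<le> \<alpha> * d x y"
    using assms(12)[of x y] x y S.zero_iff[of x x] S.zero_iff[of y y] by simp
  then have "d x y * (1 - \<alpha>) \<le> 0"
    by (simp add: algebra_simps)
  then have "d x y = 0"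
    using S.nonneg[of x y] x y assms(8-10) by (simp add: mult_le_0_iff)
  then show "x = y"
    using S.zero_iff x y by blast
qed

end
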